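(* Let $\lambda\in(0,1)$ and let $\{k_n:n\geq 1\}$ be a sequence of integers with $k_n\in\{1,\ldots,n\}$ for all $n\geq 1$ and $\lim_{n\to\infty}\frac{k_n}{n}=\lambda$. Let $\Theta\subset\mathbb{R}$ and let $\{F_\theta:\theta\in\Theta\}$ be a family of distribution functions such that, for every $\theta\in\Theta$, $F_\theta$ is continuous and strictly increasing on an interval $(\alpha_\theta,\omega_\theta)$ with $-\infty\leq\alpha_\theta<\omega_\theta\leq\infty$. Put $\mathcal{M}:=\bigcup_{\theta\in\Theta}(\alpha_\theta,\omega_\theta)$ and assume that, for every $m\in\mathcal{M}$, the equation $F_\theta^{-1}(\lambda)=m$ has a unique solution $\theta\in\Theta$, denoted by $\theta_\lambda(m)$. Let $\theta_0\in\Theta$ and let $\{X_n:n\geq 1\}$ be i.i.d. random variables with distribution function $F_{\theta_0}$; let $X_{1:n}\leq\cdots\leq X_{n:n}$ be the order statistics of $X_1,\ldots,X_n$. If the restriction of $\theta_\lambda(\cdot)$ to $(\alpha_{\theta_0},\omega_{\theta_0})$ is continuous, then $\{\theta_\lambda(X_{k_n:n}):n\geq 1\}$ satisfies the large deviation principle on $\Theta$ with good rate function $I_{\lambda,\theta_0}$ defined by $$I_{\lambda,\theta_0}(\theta):=\begin{cases}\lambda\log\dfrac{\lambda}{h_{\lambda,\theta_0}(\theta)}+(1-\lambda)\log\dfrac{1-\lambda}{1-h_{\lambda,\theta_0}(\theta)} & \text{for } \theta\in\Theta \text{ such that } F_\theta^{-1}(\lambda)\in(\alpha_{\theta_0},\omega_{\theta_0}),\\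 \infty & \text{otherwise,}\end{cases}$$ where $h_{\lambda,\theta_0}(\theta):=F_{\theta_0}(F_\theta^{-1}(\lambda))$ for $\theta$ such that $F_\theta^{-1}(\lambda)\in(\alpha_{\theta_0},\omega_{\theta_0})$.
   Context: A sequence of random variables $\{W_n:n\geq 1\}$ taking values in a topological space $\mathcal{W}$ satisfies the large deviation principle (LDP) with rate function $I:\mathcal{W}\to[0,\infty]$ if $I$ is lower semi-continuous, $\liminf_{n\to\infty}\frac1n\log P(W_n\in O)\geq-\inf_{w\in O}I(w)$ for all open sets $O$, and $\limsup_{n\to\infty}\frac1n\log P(W_n\in C)\leq-\inf_{w\in C}I(w)$ for all closed sets $C$. The rate function $I$ is good if all its level sets $\{w\in\mathcal{W}:I(w)\leq\eta\}$, $\eta\geq 0$, are compact. The interval $(\alpha_\theta,\omega_\theta)$ carries all the mass of $F_\theta$, i.e. $F_\theta(x)\to 0$ as $x\downarrow\alpha_\theta$ and $F_\theta(x)\to1$ as $x\uparrow\omega_\theta$; $F_\theta^{-1}:(0,1)\to(\alpha_\theta,\omega_\theta)$ is the inverse of the restriction of $F_\theta$ to $(\alpha_\theta,\omega_\theta)$. The set $\Theta$ has the topology inherited from $\mathbb{R}$. The random variables $X_n$ take values in $(\alpha_{\theta_0},\omega_{\theta_0})$ almost surely, so $\theta_\lambda(X_{k_n:n})$ is almost surely well defined. *)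

theory Defs
  imports "HOL-Probability.Probability"
begin

text \<open>Logarithm of a probability, with the convention that the logarithm of 0 is minus infinity
  (the library's \<^const>\<open>ln\<close> has the value 0 there).\<close>

definition log_prob :: "real \<Rightarrow> ereal" where
  "log_prob p = (if p = 0 then -\<infinity> else ereal (ln p))"

definition lower_semicontinuous_on :: "'w topology \<Rightarrow> ('w \<Rightarrow> ereal) \<Rightarrow> bool" where
  "lower_semicontinuous_on T I \<longleftrightarrow> (\<forall>a. openin T {w \<in> topspace T. a < I w})"

definition rate_function :: "'w topology \<Rightarrow> ('w \<Rightarrow> ereal) \<Rightarrow> bool" where
  "rate_function T I \<longleftrightarrow> (\<forall>w \<in> topspace T. 0 \<le> I w) \<and> lower_semicontinuous_on T I"

definition good_rate_function :: "'w topology \<Rightarrow> ('w \<Rightarrow> ereal) \<Rightarrow> bool" where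
  "good_rate_function T I \<longleftrightarrow> rate_function T I \<and>
     (\<forall>\<eta>::real. 0 \<le> \<eta> \<longrightarrow> compactin T {w \<in> topspace T. I w \<le> ereal \<eta>})"

text \<open>A random variable with values in a topological space that only needs to be defined almost
  surely: outside a null set, the value of \<^term>\<open>W\<close> may lie outside the space.
  Measurability is with respect to the Borel sets; it suffices to test the open ones.
  When \<^term>\<open>W\<close> is arbitrary on a null set, take for \<^term>\<open>P\<close> the completion of the
  given probability space, so that its events are measurable.\<close>

definition as_random_variable :: "'a measure \<Rightarrow> 'w topology \<Rightarrow> ('a \<Rightarrow> 'w) \<Rightarrow> bool" where
  "as_random_variable P T W \<longleftrightarrow>
     (AE x in P. W x \<in> topspace T) \<and>
     (\<forall>U. openin T U \<longrightarrow> {x \<in> space P. W x \<in> U} \<in> sets P)"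

definition satisfies_LDP ::
    "'a measure \<Rightarrow> 'w topology \<Rightarrow> (nat \<Rightarrow> 'a \<Rightarrow> 'w) \<Rightarrow> ('w \<Rightarrow> ereal) \<Rightarrow> bool" where
  "satisfies_LDP P T W I \<longleftrightarrow>
     (\<forall>n\<ge>1. as_random_variable P T (W n)) \<and>
     rate_function T I \<and>
     (\<forall>U. openin T U \<longrightarrow>
        - (INF w\<in>U. I w) \<le>
        liminf (\<lambda>n. ereal (1 / real n) * log_prob (measure P {x \<in> space P. W n x \<in> U}))) \<and>
     (\<forall>C. closedin T C \<longrightarrow>
        limsup (\<lambda>n. ereal (1 / real n) * log_prob (measure P {x \<in> space P. W n x \<in> C}))
        \<le> - (INF w\<in>C. I w))"

definition distribution_function :: "(real \<Rightarrow> real) \<Rightarrow> bool" where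
  "distribution_function F \<longleftrightarrow> (\<exists>\<mu>. real_distribution \<mu> \<and> F = cdf \<mu>)"

text \<open>The end points are extended reals, and the interval carries all the mass of \<^term>\<open>F\<close>.\<close>

definition regular_on_interval :: "(real \<Rightarrow> real) \<Rightarrow> ereal \<Rightarrow> ereal \<Rightarrow> bool" where
  "regular_on_interval F a b \<longleftrightarrow>
     a < b \<and>
     continuous_on (einterval a b) F \<and>
     strict_mono_on (einterval a b) F \<and>
     ((\<lambda>x. F (real_of_ereal x)) \<longlongrightarrow> 0) (at_right a) \<and>
     ((\<lambda>x. F (real_of_ereal x)) \<longlongrightarrow> 1) (at_left b)"

text \<open>Inverse of the restriction of \<^term>\<open>F\<close> to the interval; meaningful for arguments
  strictly between 0 and 1.\<close>

definition quantile :: "(real \<Rightarrow> real) \<Rightarrow> ereal \<Rightarrow> ereal \<Rightarrow> real \<Rightarrow> real" where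
  "quantile F a b = the_inv_into (einterval a b) F"

definition theta_of ::
    "real set \<Rightarrow> (real \<Rightarrow> real \<Rightarrow> real) \<Rightarrow> (real \<Rightarrow> ereal) \<Rightarrow> (real \<Rightarrow> ereal) \<Rightarrow> real \<Rightarrow> real \<Rightarrow> real"
  where
  "theta_of \<Theta> F \<alpha> \<omega> lam m =
     (THE \<theta>. \<theta> \<in> \<Theta> \<and> quantile (F \<theta>) (\<alpha> \<theta>) (\<omega> \<theta>) lam = m)"

text \<open>The k-th smallest (k from 1 to n) of X 1, ..., X n, counted with multiplicity.\<close>

definition order_stat :: "(nat \<Rightarrow> 'a \<Rightarrow> real) \<Rightarrow> nat \<Rightarrow> nat \<Rightarrow> 'a \<Rightarrow> real" where
  "order_stat X k n x = sort (map (\<lambda>i. X i x) [1..<Suc n]) ! (k - 1)"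

definition rate_I ::
    "real set \<Rightarrow> (real \<Rightarrow> real \<Rightarrow> real) \<Rightarrow> (real \<Rightarrow> ereal) \<Rightarrow> (real \<Rightarrow> ereal) \<Rightarrow> real \<Rightarrow> real \<Rightarrow> real \<Rightarrow> ereal"
  where
  "rate_I \<Theta> F \<alpha> \<omega> lam \<theta>\<^sub>0 \<theta> =
     (let q = quantile (F \<theta>) (\<alpha> \<theta>) (\<omega> \<theta>) lam; h = F \<theta>\<^sub>0 q in
      if \<theta> \<in> \<Theta> \<and> q \<in> einterval (\<alpha> \<theta>\<^sub>0) (\<omega> \<theta>\<^sub>0)
      then ereal (lam * ln (lam / h) + (1 - lam) * ln ((1 - lam) / (1 - h)))
      else \<infinity>)"

end

theory Submission
  imports Defs "HOL-Real_Asymp.Real_Asymp"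
begin

text \<open>The order statistic is at most \<open>y\<close> iff at least \<open>k\<close> of the sample points are, so both
  tails of \<open>X\<^bsub>k:n\<^esub>\<close> are binomial tails, and the exponential Markov inequality bounds them with rate
  the relative entropy of \<open>lam\<close> with respect to \<open>F \<theta>\<^sub>0\<close>; this function of \<open>F \<theta>\<^sub>0\<close> is monotone on
  either side of \<open>lam\<close>, so a union of two tails controls any set. For the lower bound, the order
  statistic lies in \<open>(y, z]\<close> as soon as \<open>k - 1\<close> of the first \<open>n - 1\<close> points are at most \<open>y\<close>, the others
  exceed \<open>z\<close>, and the last point lies in \<open>(y, z]\<close>; counting these configurations with Stirling-type
  bounds gives the same rate when \<open>y\<close> and \<open>z\<close> approach a common point. The estimates pass through
  the continuous map \<open>\<theta>\<^sub>\<lambda>\<close>, which has the quantile map as its inverse.\<close>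

subsection \<open>Relative entropy\<close>

text \<open>This is the Kullback-Leibler divergence of the Bernoulli law with parameter
  \<open>x\<close> from the one with parameter \<open>h\<close>. With \<open>x = lam\<close> it is
  the finite branch of \<open>rate_I\<close>.\<close>

definition rel_ent :: "real \<Rightarrow> real \<Rightarrow> real" where
  "rel_ent x h = x * ln (x / h) + (1 - x) * ln ((1 - x) / (1 - h))"

text \<open>Success and failure are exchanged. This symmetry carries results for
  \<open>h \<le> x\<close> over to \<open>h \<ge> x\<close>, and lower tails over to upper
  tails.\<close>

lemma rel_ent_swap: "rel_ent (1 - x) (1 - h) = rel_ent x h"
  unfolding rel_ent_def diff_diff_eq2 by (simp only: add_diff_cancel_left' add.commute)

lemma continuous_on_rel_ent:
  assumes "0 < x" "x < 1"
  shows "continuous_on {0<..<1} (rel_ent x)"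
  unfolding rel_ent_def using assms
  by (intro continuous_on_add continuous_on_mult continuous_on_ln continuous_on_divide
      continuous_on_diff continuous_on_const continuous_on_id) auto

text \<open>The derivative in \<open>h\<close> is \<open>(h - x) / (h * (1 - h))\<close>, which is
  negative to the left of \<open>x\<close>. Only its sign inside the open interval matters, so
  \<open>b = x\<close> is allowed although the derivative vanishes there.\<close>

lemma rel_ent_strict_decreasing:
  assumes "0 < x" "x < 1" "0 < a" "a < b" "b \<le> x"
  shows "rel_ent x b < rel_ent x a"
proof (rule DERIV_neg_imp_decreasing_open[OF \<open>a < b\<close>])
  fix h assume h: "a < h" "h < b"
  have "(rel_ent x has_real_derivative - x / h + (1 - x) / (1 - h)) (at h)"
  \<comment> \<open>On the unit interval the logarithms of quotients split into differences, which
    are easier to differentiate.\<close>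
  proof (rule has_field_derivative_transform_within_open)
    show "((\<lambda>h. x * (ln x - ln h) + (1 - x) * (ln (1 - x) - ln (1 - h)))
        has_real_derivative - x / h + (1 - x) / (1 - h)) (at h)"
      using assms h by (auto intro!: derivative_eq_intros)
    show "x * (ln x - ln g) + (1 - x) * (ln (1 - x) - ln (1 - g)) = rel_ent x g"
      if "g \<in> {0<..<1}" for g
      using assms that by (simp add: rel_ent_def ln_div)
  qed (use assms h in auto)
  moreover have "- x / h + (1 - x) / (1 - h) < 0"
    using assms h by (simp add: field_simps)
  ultimately show "\<exists>y. (rel_ent x has_real_derivative y) (at h) \<and> y < 0" by blast
next
  show "continuous_on {a..b} (rel_ent x)"
    using continuous_on_rel_ent[OF assms(1,2)] by (rule continuous_on_subset) (use assms in auto)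
qed

lemma rel_ent_self [simp]: "0 < x \<Longrightarrow> x < 1 \<Longrightarrow> rel_ent x x = 0"
  by (simp add: rel_ent_def)

lemma rel_ent_nonneg_left:
  assumes "0 < x" "x < 1" "0 < h" "h \<le> x"
  shows "0 \<le> rel_ent x h"
  using rel_ent_strict_decreasing[of x h x] assms by (cases "h = x") auto

lemma rel_ent_nonneg:
  assumes "0 < x" "x < 1" "0 < h" "h < 1"
  shows "0 \<le> rel_ent x h"
  using rel_ent_nonneg_left[of x h] rel_ent_nonneg_left[of "1 - x" "1 - h"] assms
  by (cases "h \<le> x") (auto simp: rel_ent_swap)

text \<open>The divergence falls continuously and strictly from arbitrarily large values near 0 to
  the value 0 at \<open>h = x\<close>. Hence each level \<open>s\<close> is attained once, and
  comparing values amounts to comparing arguments in reverse order.\<close>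

lemma rel_ent_left_level:
  assumes x: "0 < x" "x < 1" and s: "0 \<le> s"
  obtains a where "0 < a" "a \<le> x" "rel_ent x a = s"
    "\<And>h. 0 < h \<Longrightarrow> h \<le> x \<Longrightarrow> s \<le> rel_ent x h \<longleftrightarrow> h \<le> a"
    "\<And>h. 0 < h \<Longrightarrow> h \<le> x \<Longrightarrow> rel_ent x h \<le> s \<longleftrightarrow> a \<le> h"
proof -
  \<comment> \<open>This \<open>b\<close> solves
    \<open>x * ln (x / b) + (1 - x) * ln (1 - x) = s\<close>. The left side omits only the
    nonnegative term \<open>- (1 - x) * ln (1 - b)\<close> of \<open>rel_ent x b\<close>, so the
    divergence at \<open>b\<close> is at least \<open>s\<close>.\<close>
  define b where "b = x * exp (- (s - (1 - x) * ln (1 - x)) / x)"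
  have neg: "(1 - x) * ln (1 - x) \<le> 0"
    using x by (intro mult_nonneg_nonpos) auto
  have b: "0 < b" "b \<le> x"
    using x s neg unfolding b_def by (auto simp: mult_le_cancel_left1 divide_le_0_iff)
  have "x * ln (x / b) = s - (1 - x) * ln (1 - x)"
    using x by (simp add: b_def exp_minus[symmetric] ln_mult ln_div)
  moreover have "ln (1 - x) \<le> ln ((1 - x) / (1 - b))"
    using x b by (simp add: ln_div)
  hence "(1 - x) * ln (1 - x) \<le> (1 - x) * ln ((1 - x) / (1 - b))"
    using x by (intro mult_left_mono) auto
  ultimately have sb: "s \<le> rel_ent x b"
    unfolding rel_ent_def by linarith
  have "\<exists>a. b \<le> a \<and> a \<le> x \<and> rel_ent x a = s"
  proof (rule IVT2')
    show "continuous_on {b..x} (rel_ent x)"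
      using continuous_on_rel_ent[OF x] by (rule continuous_on_subset) (use b x in auto)
  qed (use sb b s x in auto)
  then obtain a where a: "b \<le> a" "a \<le> x" "rel_ent x a = s" by blast
  have lt: "rel_ent x h < rel_ent x g" if "0 < g" "g < h" "h \<le> x" for g h
    using rel_ent_strict_decreasing[of x g h] that x by auto
  show ?thesis
  proof (rule that[of a])
    show "0 < a" using a b by simp
    show "s \<le> rel_ent x h \<longleftrightarrow> h \<le> a" if "0 < h" "h \<le> x" for h
      using lt[of h a] lt[of a h] a that \<open>0 < a\<close> by (cases h a rule: linorder_cases) auto
    show "rel_ent x h \<le> s \<longleftrightarrow> a \<le> h" if "0 < h" "h \<le> x" for h
      using lt[of h a] lt[of a h] a that \<open>0 < a\<close> by (cases h a rule: linorder_cases) auto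
  qed (use a in auto)
qed

text \<open>The right-hand level point is the reflection of a left-hand one for
  \<open>1 - x\<close>. The last two properties serve the upper bound and the compactness of level
  sets, respectively.\<close>

lemma rel_ent_level:
  assumes x: "0 < x" "x < 1" and s: "0 \<le> s"
  obtains a b where "0 < a" "a \<le> x" "x \<le> b" "b < 1" "rel_ent x a = s" "rel_ent x b = s"
    "\<And>h. 0 < h \<Longrightarrow> h < 1 \<Longrightarrow> s \<le> rel_ent x h \<Longrightarrow> h \<le> a \<or> b \<le> h"
    "\<And>h. 0 < h \<Longrightarrow> h < 1 \<Longrightarrow> rel_ent x h \<le> s \<longleftrightarrow> a \<le> h \<and> h \<le> b"
proof -
  obtain a where a: "0 < a" "a \<le> x" "rel_ent x a = s"
    "\<And>h. 0 < h \<Longrightarrow> h \<le> x \<Longrightarrow> s \<le> rel_ent x h \<longleftrightarrow> h \<le> a"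
    "\<And>h. 0 < h \<Longrightarrow> h \<le> x \<Longrightarrow> rel_ent x h \<le> s \<longleftrightarrow> a \<le> h"
    using rel_ent_left_level[OF x s] by blast
  have x': "0 < 1 - x" "1 - x < 1" using x by auto
  obtain c where c: "0 < c" "c \<le> 1 - x" "rel_ent (1 - x) c = s"
    "\<And>h. 0 < h \<Longrightarrow> h \<le> 1 - x \<Longrightarrow> s \<le> rel_ent (1 - x) h \<longleftrightarrow> h \<le> c"
    "\<And>h. 0 < h \<Longrightarrow> h \<le> 1 - x \<Longrightarrow> rel_ent (1 - x) h \<le> s \<longleftrightarrow> c \<le> h"
    using rel_ent_left_level[OF x' s] by blast
  show ?thesis
  proof (rule that[of a "1 - c"])
    show "rel_ent x (1 - c) = s"
      using c(3) rel_ent_swap[of "x" "1 - c"] by simp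
    show "h \<le> a \<or> 1 - c \<le> h" if "0 < h" "h < 1" "s \<le> rel_ent x h" for h
      using a(4)[of h] c(4)[of "1 - h"] that by (cases "h \<le> x") (auto simp: rel_ent_swap)
    show "rel_ent x h \<le> s \<longleftrightarrow> a \<le> h \<and> h \<le> 1 - c" if "0 < h" "h < 1" for h
      using a(2) c(2) a(5)[of h] c(5)[of "1 - h"] that by (cases "h \<le> x") (auto simp: rel_ent_swap)
  qed (use a c in auto)
qed

subsection \<open>Entropy bound for binomial coefficients\<close>

text \<open>Passing from \<open>n\<close> to \<open>n + 1\<close> multiplies the left side by
  \<open>(n + 1) * (1 + 1/n)^n / exp 1\<close>, which is at most \<open>n + 1\<close>.\<close>

lemma fact_ge_power_div_exp: "real n ^ n / exp (real n) \<le> fact n"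
proof (induction n)
  case (Suc n)
  have "(1 + real n) ^ n \<le> exp 1 * real n ^ n"
  proof (cases "n = 0")
    case False
    have "(1 + 1 / real n) ^ n \<le> exp 1"
      using exp_ge_one_plus_x_over_n_power_n[of n 1] False by simp
    moreover have "(1 + real n) ^ n = (1 + 1 / real n) ^ n * real n ^ n"
      using False by (simp add: power_mult_distrib[symmetric] field_simps)
    ultimately show ?thesis by (simp add: mult_right_mono)
  qed simp
  hence "(1 + real n) ^ n / exp (1 + real n) \<le> exp 1 * real n ^ n / exp (1 + real n)"
    by (intro divide_right_mono) auto
  also have "\<dots> = real n ^ n / exp (real n)" by (simp add: exp_add)
  also have "\<dots> \<le> fact n" by (rule Suc)
  finally have "(1 + real n) * ((1 + real n) ^ n / exp (1 + real n)) \<le> (1 + real n) * fact n"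
    by (intro mult_left_mono) auto
  thus ?case by (simp add: add_ac)
qed simp

text \<open>For \<open>n \<ge> 1\<close> the sharper factor \<open>exp 1 * real n\<close> survives
  the induction because \<open>(1 + 1/n)^(n + 1) \<ge> exp 1\<close>. The factor
  \<open>n + 1\<close> covers \<open>n = 0\<close> as well.\<close>

lemma fact_le_power_div_exp: "fact n \<le> exp 1 * real (n + 1) * (real n ^ n / exp (real n))"
proof -
  have "fact n \<le> exp 1 * real n * (real n ^ n / exp (real n))" if "n \<ge> 1"
    using that
  proof (induction n rule: dec_induct)
    case (step n)
    hence n: "real n > 0" by simp
    \<comment> \<open>The reciprocal of \<open>1 + 1/n\<close> is \<open>1 - 1/(n + 1)\<close>, so
      \<open>ln (1 - t) \<le> - t\<close> yields a lower bound for
      \<open>ln (1 + 1/n)\<close>.\<close>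
    have "- ln (1 + 1 / real n) = ln (1 - 1 / (real n + 1))"
      using n by (subst ln_inverse[symmetric]) (auto simp: field_simps)
    also have "\<dots> \<le> - (1 / (real n + 1))"
      using n by (intro ln_one_minus_pos_upper_bound) auto
    finally have "1 \<le> (real n + 1) * ln (1 + 1 / real n)"
      using n by (simp add: field_simps)
    hence "exp 1 \<le> exp (real (Suc n) * ln (1 + 1 / real n))"
      by (simp add: add.commute)
    also have "\<dots> = (1 + 1 / real n) ^ Suc n"
      using n by (simp only: exp_of_nat_mult) (simp add: add_pos_pos)
    also have "\<dots> = (1 + real n) ^ Suc n / real n ^ Suc n"
      using n by (simp only: power_divide[symmetric]) (simp add: add_divide_distrib add.commute)
    finally have *: "exp 1 * real n ^ Suc n \<le> (1 + real n) ^ Suc n"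
      using n by (simp add: pos_le_divide_eq del: power_Suc)
    have "fact (Suc n) = (1 + real n) * fact n" by simp
    also have "\<dots> \<le> (1 + real n) * (exp 1 * real n * (real n ^ n / exp (real n)))"
      by (intro mult_left_mono step.IH) auto
    also have "\<dots> = (1 + real n) * (exp 1 * real n ^ Suc n) / exp (real n)"
      by simp
    also have "\<dots> \<le> (1 + real n) * ((1 + real n) ^ Suc n) / exp (real n)"
      by (intro divide_right_mono mult_left_mono *) auto
    also have "\<dots> = exp 1 * real (Suc n) * (real (Suc n) ^ Suc n / exp (real (Suc n)))"
      by (simp add: exp_add del: power_Suc)
    finally show ?case .
  qed simp
  moreover have "exp 1 * real n * (real n ^ n / exp (real n))
      \<le> exp 1 * real (n + 1) * (real n ^ n / exp (real n))"
    by (intro mult_right_mono mult_left_mono) auto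
  ultimately show ?thesis by (cases "n = 0") auto
qed

text \<open>Both factorial bounds are inserted into \<open>n! / (j! (n - j)!)\<close>. The linear
  terms cancel, and each factorial in the denominator costs \<open>1 + ln (n + 1)\<close>.\<close>

lemma ln_binomial_ge:
  assumes "0 < j" "j < n"
  shows "- (j * ln (j / n)) - (real n - j) * ln (1 - j / n) - 2 - 2 * ln (real n + 1)
    \<le> ln (real (n choose j))"
proof -
  define i where "i = n - j"
  have n: "n = j + i" and i: "0 < i" using assms by (auto simp: i_def)
  have fact_le: "ln (fact m :: real) \<le> 1 + ln (n + 1) + m * ln m - m" if "0 < m" "m \<le> n" for m
  proof -
    have "ln (fact m :: real) \<le> ln (exp 1 * real (m + 1) * (real m ^ m / exp (real m)))"
      using fact_le_power_div_exp[of m] by (subst ln_le_cancel_iff) (use that in auto)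
    also have "\<dots> = 1 + ln (m + 1) + m * ln m - m"
      using that by (simp add: ln_mult ln_div ln_realpow add_pos_pos)
    also have "ln (m + 1) \<le> ln (n + 1)" using that by simp
    finally show ?thesis by simp
  qed
  have "n * ln n - n = ln (real n ^ n / exp (real n))"
    using n i by (simp add: ln_div ln_realpow)
  also have "\<dots> \<le> ln (fact n)"
    using fact_ge_power_div_exp[of n] n i by (subst ln_le_cancel_iff) auto
  finally have "n * ln n - n \<le> ln (fact n)" .
  moreover have "ln (real (n choose j)) = ln (fact n) - ln (fact j) - ln (fact i)"
    using assms by (simp add: binomial_fact ln_div ln_mult i_def)
  moreover have ln_eqs: "ln (j / n) = ln j - ln n" "ln (1 - j / n) = ln i - ln n"
    using assms i ln_div[of "real i" "real n"] by (simp_all add: ln_div i_def of_nat_diff diff_divide_distrib)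
  moreover have "real n * ln n - n = j * ln n + i * ln n - j - i"
    by (simp_all add: n distrib_right)
  moreover have "real n - real j = real i"
    by (simp add: n)
  moreover have "ln (fact j :: real) \<le> 1 + ln (real n + 1) + j * ln j - j"
    "ln (fact i :: real) \<le> 1 + ln (real n + 1) + i * ln i - i"
    using fact_le[of j] fact_le[of i] assms i by (simp_all add: i_def add.commute)
  ultimately show ?thesis
    unfolding ln_eqs by (simp only: right_diff_distrib)
qed

text \<open>Both arguments are lowered by one because one sample point is reserved for the target
  interval. This shift and the logarithmic error vanish after division by \<open>n\<close>.\<close>

lemma binomial_entropy_lower_bound:
  fixes k :: "nat \<Rightarrow> nat"
  assumes lam: "0 < lam" "lam < 1"
    and k: "\<And>n. 1 \<le> n \<Longrightarrow> k n \<in> {1..n}"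
    and lim: "(\<lambda>n. real (k n) / real n) \<longlonglongrightarrow> lam"
  obtains g where "g \<longlonglongrightarrow> - (lam * ln lam) - (1 - lam) * ln (1 - lam)"
    "\<forall>\<^sub>F n in sequentially. g n \<le> ln (real ((n - 1) choose (k n - 1))) / real n"
proof -
  define r where "r n = real (k n - 1) / real (n - 1)" for n
  have "(\<lambda>n. (real (k n) / real n - 1 / real n) * (real n / (real n - 1))) \<longlonglongrightarrow> (lam - 0) * 1"
    by (intro tendsto_intros lim) real_asymp+
  moreover have "\<forall>\<^sub>F n in sequentially.
      (real (k n) / real n - 1 / real n) * (real n / (real n - 1)) = r n"
    using eventually_gt_at_top[of 1]
  proof eventually_elim
    case (elim n)
    thus ?case using k[of n] by (simp add: r_def of_nat_diff field_simps)
  qed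
  ultimately have r: "r \<longlonglongrightarrow> lam"
    using Lim_transform_eventually by force
  \<comment> \<open>This is the bound of \<open>ln_binomial_ge\<close> for \<open>n - 1\<close> and
    \<open>k n - 1\<close>, divided by \<open>n\<close>. The factor \<open>1 - 1/n\<close> is
    \<open>(n - 1) / n\<close>.\<close>
  define g where "g n = (1 - 1 / real n) * (- (r n * ln (r n)) - (1 - r n) * ln (1 - r n))
    - (2 + 2 * ln (real n)) / real n" for n
  have "g \<longlonglongrightarrow> (1 - 0) * (- (lam * ln lam) - (1 - lam) * ln (1 - lam)) - 0"
    unfolding g_def by (intro tendsto_intros r) (use lam in \<open>simp_all, real_asymp+\<close>)
  moreover have "\<forall>\<^sub>F n in sequentially. g n \<le> ln (real ((n - 1) choose (k n - 1))) / real n"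
    using eventually_gt_at_top[of 1] order_tendstoD(1)[OF r lam(1)] order_tendstoD(2)[OF r lam(2)]
  proof eventually_elim
    case (elim n)
    \<comment> \<open>The limit \<open>lam\<close> of \<open>r\<close> lies strictly between 0 and
      1, which eventually makes both inequalities strict.\<close>
    hence "0 < k n - 1" "k n - 1 < n - 1" by (auto simp: r_def field_simps zero_less_divide_iff)
    from ln_binomial_ge[OF this]
    have "(- (real (k n - 1) * ln (r n)) - (real (n - 1) - real (k n - 1)) * ln (1 - r n)
        - 2 - 2 * ln (real (n - 1) + 1)) / real n \<le> ln (real ((n - 1) choose (k n - 1))) / real n"
      by (intro divide_right_mono) (auto simp: r_def)
    moreover have "(- (real (k n - 1) * ln (r n)) - (real (n - 1) - real (k n - 1)) * ln (1 - r n)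
        - 2 - 2 * ln (real (n - 1) + 1)) / real n = g n"
    proof -
      have "real (k n - 1) = r n * (real n - 1)" using elim by (simp add: r_def of_nat_diff)
      moreover have "real (n - 1) = real n - 1" using elim by simp
      ultimately show ?thesis using elim unfolding g_def by (simp add: divide_simps) (simp add: algebra_simps)
    qed
    ultimately show ?case by simp
  qed
  ultimately show ?thesis using that[of g] by simp
qed

subsection \<open>Order statistics and quantiles\<close>

text \<open>A downward closed \<open>Q\<close> holds exactly on an initial segment of a sorted list,
  and the filtered length is the length of that segment.\<close>

lemma sorted_nth_iff_length_filter:
  fixes xs :: "'a :: linorder list"
  assumes "sorted xs" "j < length xs" "\<And>y z. y \<le> z \<Longrightarrow> Q z \<Longrightarrow> Q y"
  shows "Q (xs ! j) \<longleftrightarrow> j < length (filter Q xs)"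
  using assms(1,2)
proof (induction xs arbitrary: j)
  case (Cons a xs)
  show ?case
  proof (cases "Q a")
    case True
    thus ?thesis using Cons by (cases j) auto
  next
    case False
    hence "\<not> Q y" if "y \<in> set (a # xs)" for y
      using that Cons.prems(1) assms(3)[of a y] by auto
    hence "filter Q (a # xs) = []" "\<not> Q ((a # xs) ! j)"
      using Cons.prems(2) nth_mem[of j "a # xs"] by (auto simp: filter_empty_conv simp del: nth_mem)
    thus ?thesis by simp
  qed
qed simp

text \<open>A general downward closed \<open>Q\<close> treats \<open>t \<le> y\<close> and
  \<open>t < y\<close> at once; the strict version is what the upper tail needs.\<close>

lemma order_stat_iff_card:
  assumes k: "k \<in> {1..n}" and Q: "\<And>y z. y \<le> z \<Longrightarrow> Q z \<Longrightarrow> Q y"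
  shows "Q (order_stat X k n x) \<longleftrightarrow> k \<le> card {i \<in> {1..n}. Q (X i x)}"
proof -
  define xs where "xs = map (\<lambda>i. X i x) [1..<Suc n]"
  have "length (filter Q (sort xs)) = length (filter Q xs)"
    by (metis mset_filter mset_sort size_mset)
  also have "\<dots> = card {i \<in> {1..n}. Q (X i x)}"
    unfolding xs_def
    by (auto simp: filter_map distinct_length_filter o_def simp del: upt_Suc
        intro!: arg_cong[of _ _ card])
  moreover have "Q (sort xs ! (k - 1)) \<longleftrightarrow> k - 1 < length (filter Q (sort xs))"
    by (rule sorted_nth_iff_length_filter) (use k Q in \<open>auto simp: xs_def\<close>)
  ultimately show ?thesis
    using k by (auto simp: order_stat_def xs_def)
qed

lemma order_stat_mem:
  assumes "k \<in> {1..n}" "\<And>i. i \<in> {1..n} \<Longrightarrow> X i x \<in> S"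
  shows "order_stat X k n x \<in> S"
proof -
  have "order_stat X k n x \<in> set (sort (map (\<lambda>i. X i x) [1..<Suc n]))"
    unfolding order_stat_def using assms(1) by (intro nth_mem) auto
  thus ?thesis using assms(2) by auto
qed

text \<open>The interval is open, so there are further points on both sides of \<open>x\<close>.
  Strict monotonicity moves \<open>F x\<close> away from the bounds 0 and 1 of a distribution
  function.\<close>

lemma regular_on_interval_bounds:
  assumes F: "distribution_function F" and reg: "regular_on_interval F a b"
    and x: "x \<in> einterval a b"
  shows "0 < F x" "F x < 1"
proof -
  from F obtain \<mu> where \<mu>: "real_distribution \<mu>" and F_eq: "F = cdf \<mu>"
    by (auto simp: distribution_function_def)
  interpret real_distribution \<mu> by fact
  have mono: "strict_mono_on (einterval a b) F" using reg by (simp add: regular_on_interval_def)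
  obtain y where "y \<in> einterval a (ereal x)"
    using einterval_nonempty[of a "ereal x"] x by (auto simp: einterval_iff)
  hence "F y < F x"
    using x by (intro strict_mono_onD[OF mono])
      (auto simp: einterval_iff intro: order.strict_trans[of "ereal y" "ereal x" b])
  thus "0 < F x" using cdf_nonneg[of y] by (simp add: F_eq)
  obtain z where "z \<in> einterval (ereal x) b"
    using einterval_nonempty[of "ereal x" b] x by (auto simp: einterval_iff)
  hence "F x < F z"
    using x by (intro strict_mono_onD[OF mono])
      (auto simp: einterval_iff intro: order.strict_trans[of a "ereal x" "ereal z"])
  thus "F x < 1" using cdf_bounded_prob[of z] by (simp add: F_eq)
qed

text \<open>The limits at the end points provide values below and above \<open>p\<close>, and the
  intermediate value theorem applies between them.\<close>

lemma regular_on_interval_surj: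
  assumes reg: "regular_on_interval F a b" and p: "0 < p" "p < 1"
  obtains x where "x \<in> einterval a b" "F x = p"
proof -
  have ab: "a < b" and cont: "continuous_on (einterval a b) F"
    and mono: "strict_mono_on (einterval a b) F"
    and lim: "((\<lambda>x. F (real_of_ereal x)) \<longlongrightarrow> 0) (at_right a)"
      "((\<lambda>x. F (real_of_ereal x)) \<longlongrightarrow> 1) (at_left b)"
    using reg by (auto simp: regular_on_interval_def)
  obtain c where c: "a < c" "\<And>y. a < y \<Longrightarrow> y < c \<Longrightarrow> F (real_of_ereal y) < p"
    using order_tendstoD(2)[OF lim(1) p(1)] unfolding eventually_at_right[OF ab] by blast
  \<comment> \<open>The minimum keeps \<open>y\<close> inside the interval and also close enough to
    \<open>a\<close> for \<open>F y < p\<close>.\<close>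
  obtain y where y: "y \<in> einterval a (min b c)"
    using einterval_nonempty[of a "min b c"] c(1) ab by auto
  obtain d where d: "d < b" "\<And>y. d < y \<Longrightarrow> y < b \<Longrightarrow> p < F (real_of_ereal y)"
    using order_tendstoD(1)[OF lim(2) p(2)] unfolding eventually_at_left[OF ab] by blast
  obtain z where z: "z \<in> einterval (max a d) b"
    using einterval_nonempty[of "max a d" b] d(1) ab by auto
  have mem: "y \<in> einterval a b" "z \<in> einterval a b"
    using y z by (auto simp: einterval_iff)
  have Fy: "F y < p" "p < F z"
    using c(2)[of "ereal y"] y d(2)[of "ereal z"] z by (auto simp: einterval_iff)
  have "y < z"
  proof (rule ccontr)
    assume "\<not> y < z"
    hence "F z \<le> F y" using mem by (cases "y = z") (auto intro!: less_imp_le strict_mono_onD[OF mono])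
    thus False using Fy by simp
  qed
  have sub: "{y..z} \<subseteq> einterval a b"
    using mem by (auto simp: einterval_iff) (meson ereal_less_eq(3) less_le_trans le_less_trans)+
  have "\<exists>x\<ge>y. x \<le> z \<and> F x = p"
    using \<open>y < z\<close> Fy by (intro IVT' continuous_on_subset[OF cont sub]) auto
  thus ?thesis using that sub by auto
qed

lemma quantile_props:
  assumes reg: "regular_on_interval F a b" and p: "0 < p" "p < 1"
  shows "quantile F a b p \<in> einterval a b" "F (quantile F a b p) = p"
proof -
  have inj: "inj_on F (einterval a b)"
    using reg by (auto simp: regular_on_interval_def intro: strict_mono_on_imp_inj_on)
  obtain x where "x \<in> einterval a b" "F x = p"
    using regular_on_interval_surj[OF reg p] .
  hence "p \<in> F ` einterval a b" by blast
  thus "quantile F a b p \<in> einterval a b" "F (quantile F a b p) = p"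
    unfolding quantile_def using f_the_inv_into_f[OF inj] the_inv_into_into[OF inj _ order_refl]
    by auto
qed

subsection \<open>Tail estimates\<close>

lemma log_prob_le:
  assumes "1 \<le> n" "0 \<le> p" "p \<le> exp (real n * u)"
  shows "ereal (1 / real n) * log_prob p \<le> ereal u"
proof (cases "p = 0")
  case True
  thus ?thesis using assms by (simp add: log_prob_def)
next
  case False
  hence "ln p \<le> ln (exp (real n * u))" using assms by (subst ln_le_cancel_iff) auto
  hence "ln p \<le> real n * u" by simp
  thus ?thesis using False assms by (simp add: log_prob_def field_simps)
qed

lemma log_prob_ge:
  assumes "1 \<le> n" "exp (real n * l) \<le> p"
  shows "ereal l \<le> ereal (1 / real n) * log_prob p"
proof -
  have "0 < p" using assms(2) exp_gt_zero[of "real n * l"] by linarith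
  hence "real n * l \<le> ln p" using assms by (simp add: ln_ge_iff)
  thus ?thesis using \<open>0 < p\<close> assms by (simp add: log_prob_def field_simps)
qed

context prob_space
begin

text \<open>Markov's inequality is applied to \<open>c\<close> raised to the number of hits of
  \<open>B\<close>. By independence the expectation of this power factors into the generating
  function of a binomial law.\<close>

lemma prob_card_ge_le:
  fixes X :: "nat \<Rightarrow> 'a \<Rightarrow> real"
  assumes indep: "indep_vars (\<lambda>_. borel) X I" and I: "finite I" and B: "B \<in> sets borel"
    and p: "\<And>i. i \<in> I \<Longrightarrow> prob {x \<in> space M. X i x \<in> B} = p" and c: "1 \<le> c"
  shows "prob {x \<in> space M. j \<le> card {i \<in> I. X i x \<in> B}} \<le> (1 - p + p * c) ^ card I / c ^ j"
proof -
  \<comment> \<open>Each hit of \<open>B\<close> contributes the factor \<open>c\<close> and each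
    miss the factor 1, so the product over \<open>I\<close> counts hits in the exponent.\<close>
  define f :: "real \<Rightarrow> real" where "f t = 1 + (c - 1) * indicator B t" for t
  have [measurable]: "f \<in> borel_measurable borel" unfolding f_def using B by measurable
  have X: "random_variable borel (X i)" if "i \<in> I" for i
    using indep that by (simp add: indep_vars_def)
  have bounds: "1 \<le> f t" "f t \<le> c" for t
    using c by (auto simp: f_def indicator_def)
  have abs_bound: "\<bar>f t\<bar> \<le> c" for t
    using bounds[of t] by linarith
  have indep': "indep_vars (\<lambda>_. borel) (\<lambda>i x. f (X i x)) I"
    by (rule indep_vars_compose2[OF indep]) simp
  have int: "integrable M (\<lambda>x. f (X i x))" if "i \<in> I" for i
    using X[OF that] abs_bound by (intro integrable_const_bound[of _ c]) auto
  have "(\<integral>x. f (X i x) \<partial>M) = 1 - p + p * c" if i: "i \<in> I" for i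
  proof -
    note [measurable] = X[OF i] B
    have "(\<integral>x. f (X i x) \<partial>M) = (\<integral>x. 1 + (c - 1) * indicator {x \<in> space M. X i x \<in> B} x \<partial>M)"
      by (intro Bochner_Integration.integral_cong) (auto simp: f_def indicator_def)
    also have "\<dots> = 1 + (c - 1) * prob {x \<in> space M. X i x \<in> B}"
      by (subst Bochner_Integration.integral_add) (auto simp: prob_space emeasure_eq_measure Int_absorb2)
    finally show ?thesis using p[OF i] by (simp add: algebra_simps)
  qed
  hence E: "(\<integral>x. (\<Prod>i\<in>I. f (X i x)) \<partial>M) = (1 - p + p * c) ^ card I"
    by (subst indep_vars_lebesgue_integral[OF I indep' int]) auto
  have "(\<Prod>i\<in>I. f (X i x)) = c ^ card {i \<in> I. X i x \<in> B}" for x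
  proof -
    have "(\<Prod>i\<in>I. f (X i x)) = (\<Prod>i\<in>I. if X i x \<in> B then c else 1)"
      by (intro prod.cong) (auto simp: f_def)
    also have "\<dots> = (\<Prod>i\<in>{i \<in> I. X i x \<in> B}. c)"
      by (rule prod.inter_filter[OF I, symmetric])
    finally show ?thesis by simp
  qed
  hence "j \<le> card {i \<in> I. X i x \<in> B} \<Longrightarrow> c ^ j \<le> (\<Prod>i\<in>I. f (X i x))" for x
    using c by (simp add: power_increasing)
  moreover have "{x \<in> space M. c ^ j \<le> (\<Prod>i\<in>I. f (X i x))} \<in> events"
    using X by measurable
  ultimately have "prob {x \<in> space M. j \<le> card {i \<in> I. X i x \<in> B}}
      \<le> prob {x \<in> space M. c ^ j \<le> (\<Prod>i\<in>I. f (X i x))}"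
    by (intro finite_measure_mono) auto
  also have "\<dots> \<le> (\<integral>x. (\<Prod>i\<in>I. f (X i x)) \<partial>M) / c ^ j"
  proof (rule integral_Markov_inequality_measure[where A = "space M"])
    show "integrable M (\<lambda>x. \<Prod>i\<in>I. f (X i x))"
      by (rule indep_vars_integrable[OF I indep' int])
    show "AE x in M. 0 \<le> (\<Prod>i\<in>I. f (X i x))"
      using bounds(1) by (intro AE_I2 prod_nonneg) (auto intro: order.trans[of 0 1])
  qed (use c in auto)
  finally show ?thesis by (simp add: E)
qed

text \<open>The tilt \<open>c\<close> below makes the tilted success probability equal to \<open>lam\<close>, which is the
  optimal choice in the exponential Markov inequality.\<close>

lemma prob_card_ge_rate:
  fixes X :: "nat \<Rightarrow> 'a \<Rightarrow> real"
  assumes indep: "indep_vars (\<lambda>_. borel) X {1..}" and B: "B \<in> sets borel"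
    and p: "\<And>i. 1 \<le> i \<Longrightarrow> prob {x \<in> space M. X i x \<in> B} = p" "0 < p" "p \<le> lam" and lam: "lam < 1"
    and lim: "(\<lambda>n. real (j n) / real n) \<longlonglongrightarrow> lam"
  obtains u where "u \<longlonglongrightarrow> - rel_ent lam p"
    "\<And>n. 1 \<le> n \<Longrightarrow> prob {x \<in> space M. j n \<le> card {i \<in> {1..n}. X i x \<in> B}} \<le> exp (real n * u n)"
proof -
  define c where "c = lam * (1 - p) / ((1 - lam) * p)"
  define u where "u n = ln ((1 - p) / (1 - lam)) - (real (j n) / real n) * ln c" for n
  \<comment> \<open>This is where \<open>p \<le> lam\<close> enters: the tilt must favour hits of
    \<open>B\<close>.\<close>
  have c: "1 \<le> c" using p lam by (simp add: c_def field_simps)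
  have base: "1 - p + p * c = (1 - p) / (1 - lam)" using p lam by (simp add: c_def field_simps)
  have "u \<longlonglongrightarrow> ln ((1 - p) / (1 - lam)) - lam * ln c"
    unfolding u_def by (intro tendsto_intros lim)
  also have "ln ((1 - p) / (1 - lam)) - lam * ln c = - rel_ent lam p"
  proof -
    have "ln c = ln lam + ln (1 - p) - (ln (1 - lam) + ln p)"
      using p lam by (simp add: c_def ln_div ln_mult)
    thus ?thesis using p lam by (simp only:) (simp add: rel_ent_def ln_div algebra_simps)
  qed
  finally have "u \<longlonglongrightarrow> - rel_ent lam p" .
  moreover have "prob {x \<in> space M. j n \<le> card {i \<in> {1..n}. X i x \<in> B}} \<le> exp (real n * u n)"
    if n: "1 \<le> n" for n
  proof -
    have "prob {x \<in> space M. j n \<le> card {i \<in> {1..n}. X i x \<in> B}}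
        \<le> (1 - p + p * c) ^ card {1..n} / c ^ j n"
      by (rule prob_card_ge_le[OF indep_vars_subset[OF indep] _ B _ c]) (use p in auto)
    also have "\<dots> = exp (real n * ln ((1 - p) / (1 - lam)) - real (j n) * ln c)"
      using p lam c unfolding base by (simp add: exp_diff exp_of_nat_mult)
    also have "real n * ln ((1 - p) / (1 - lam)) - real (j n) * ln c = real n * u n"
      using n by (simp add: u_def algebra_simps)
    finally show ?thesis .
  qed
  ultimately show ?thesis using that by blast
qed

text \<open>For each set \<open>S\<close> of \<open>k - 1\<close> indices below \<open>n\<close>,
  let the points in \<open>S\<close> be at most \<open>y\<close>, point \<open>n\<close> lie in the
  interval, and the rest exceed \<open>z\<close>. These events are disjoint, equally likely, and
  force the order statistic into the interval.\<close>

lemma prob_order_stat_ge: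
  fixes X :: "nat \<Rightarrow> 'a \<Rightarrow> real"
  assumes indep: "indep_vars (\<lambda>_. borel) X {1..n}" and k: "k \<in> {1..n}" and yz: "y < z"
    and p: "\<And>i. i \<in> {1..n} \<Longrightarrow> prob {x \<in> space M. X i x \<le> y} = p"
    and q: "\<And>i. i \<in> {1..n} \<Longrightarrow> prob {x \<in> space M. X i x \<le> z} = q"
    and meas: "{x \<in> space M. order_stat X k n x \<in> {y<..z}} \<in> events"
  shows "real ((n - 1) choose (k - 1)) * (p ^ (k - 1) * (q - p) * (1 - q) ^ (n - k))
    \<le> prob {x \<in> space M. order_stat X k n x \<in> {y<..z}}"
proof -
  obtain m where n: "n = Suc m" using k by (cases n) auto
  have X [measurable]: "random_variable borel (X i)" if "i \<in> {1..n}" for i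
    using indep that by (simp add: indep_vars_def)
  define \<S> where "\<S> = {S. S \<subseteq> {1..m} \<and> card S = k - 1}"
  define B where "B S i = (if i = n then {y<..z} else if i \<in> S then {..y} else {z<..})"
    for S :: "nat set" and i
  define E where "E S = (\<Inter>i\<in>{1..n}. X i -` B S i \<inter> space M)" for S
  have prob_le: "prob (X i -` {..y} \<inter> space M) = p" "prob (X i -` {..z} \<inter> space M) = q"
    if "i \<in> {1..n}" for i
    using p[OF that] q[OF that] by (auto simp: vimage_def Int_def conj_commute)
  have prob_Ioc: "prob (X i -` {y<..z} \<inter> space M) = q - p" if i: "i \<in> {1..n}" for i
  proof -
    have eq: "X i -` {y<..z} \<inter> space M = (X i -` {..z} \<inter> space M) - (X i -` {..y} \<inter> space M)" by auto
    show ?thesis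
      unfolding eq using yz prob_le[OF i] X[OF i] by (subst finite_measure_Diff) auto
  qed
  have prob_Ioi: "prob (X i -` {z<..} \<inter> space M) = 1 - q" if i: "i \<in> {1..n}" for i
  proof -
    have "X i -` {z<..} \<inter> space M = space M - (X i -` {..z} \<inter> space M)" by auto
    thus ?thesis
      using prob_le[OF i] X[OF i] by (simp add: prob_compl)
  qed
  have prob_E: "prob (E S) = p ^ (k - 1) * (q - p) * (1 - q) ^ (n - k)" if S: "S \<in> \<S>" for S
  proof -
    have S': "finite S" "S \<subseteq> {1..m}" "card S = k - 1"
      using S finite_subset[of S "{1..m}"] by (auto simp: \<S>_def)
    have "prob (E S) = (\<Prod>i\<in>{1..n}. prob (X i -` B S i \<inter> space M))"
      unfolding E_def by (rule indep_varsD[OF indep]) (auto simp: n B_def)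
    also have "\<dots> = (\<Prod>i\<in>{1..m}. if i \<in> S then p else 1 - q) * (q - p)"
      unfolding n prod.nat_ivl_Suc'[of 1 m, simplified]
      using prob_le(1) prob_Ioi prob_Ioc[of n]
      by (auto simp: n B_def intro!: prod.cong)
    also have "(\<Prod>i\<in>{1..m}. if i \<in> S then p else 1 - q)
        = p ^ card ({1..m} \<inter> S) * (1 - q) ^ card ({1..m} - S)"
      by (simp add: prod.If_cases Diff_eq)
    also have "{1..m} \<inter> S = S" using S' by auto
    also have "card ({1..m} - S) = n - k"
      using S' k by (simp add: card_Diff_subset n)
    finally show ?thesis using S' by (simp add: mult_ac)
  qed
  \<comment> \<open>The sample determines \<open>S\<close>, which makes the events disjoint. The two
    counts \<open>k - 1\<close> and \<open>k\<close> then locate the order statistic.\<close>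
  have E_sets: "{i \<in> {1..n}. X i x \<le> y} = S" "{i \<in> {1..n}. X i x \<le> z} = insert n S"
    if "S \<in> \<S>" "x \<in> E S" for S x
  proof -
    have S: "S \<subseteq> {1..n}" "n \<notin> S" "n \<in> {1..n}"
      using \<open>S \<in> \<S>\<close> by (auto simp: \<S>_def n)
    have B: "X i x \<in> B S i" if "i \<in> {1..n}" for i
      using that \<open>x \<in> E S\<close> by (auto simp: E_def)
    have "X i x \<le> y \<longleftrightarrow> i \<in> S" "X i x \<le> z \<longleftrightarrow> i \<in> insert n S" if "i \<in> {1..n}" for i
      using B[OF that] yz S by (auto simp: B_def split: if_splits)
    thus "{i \<in> {1..n}. X i x \<le> y} = S" "{i \<in> {1..n}. X i x \<le> z} = insert n S"
      using S by blast+
  qed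
  have "real ((n - 1) choose (k - 1)) * (p ^ (k - 1) * (q - p) * (1 - q) ^ (n - k))
      = (\<Sum>S\<in>\<S>. prob (E S))"
    using n_subsets[of "{1..m}" "k - 1"] by (simp add: prob_E) (simp add: \<S>_def n)
  also have "\<dots> = prob (\<Union>S\<in>\<S>. E S)"
  proof (rule finite_measure_finite_Union[symmetric])
    show "finite \<S>" by (simp add: \<S>_def)
    show "E ` \<S> \<subseteq> events"
      unfolding E_def
      by (intro image_subsetI sets.finite_INT measurable_sets[OF X]) (auto simp: B_def n)
    show "disjoint_family_on E \<S>"
      using E_sets(1) unfolding disjoint_family_on_def by blast
  qed
  also have "\<dots> \<le> prob {x \<in> space M. order_stat X k n x \<in> {y<..z}}"
  proof (rule finite_measure_mono[OF _ meas], safe)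
    fix S x assume S: "S \<in> \<S>" and x: "x \<in> E S"
    show "x \<in> space M" using x by (auto simp: E_def n)
    have "finite S" "card S = k - 1" "n \<notin> S"
      using S finite_subset[of S "{1..m}"] by (auto simp: \<S>_def n)
    hence "\<not> k \<le> card {i \<in> {1..n}. X i x \<le> y}" "k \<le> card {i \<in> {1..n}. X i x \<le> z}"
      unfolding E_sets[OF S x] using k by auto
    thus "order_stat X k n x \<in> {y<..z}"
      using order_stat_iff_card[OF k, of "\<lambda>t. t \<le> y" X x] order_stat_iff_card[OF k, of "\<lambda>t. t \<le> z" X x]
      by auto
  qed
  finally show ?thesis .
qed

lemma random_variable_order_stat:
  fixes X :: "nat \<Rightarrow> 'a \<Rightarrow> real"
  assumes k: "k \<in> {1..n}" and X: "\<And>i. i \<in> {1..n} \<Longrightarrow> random_variable borel (X i)"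
  shows "random_variable borel (order_stat X k n)"
proof (rule borel_measurableI_le)
  fix y
  have "{x \<in> space M. order_stat X k n x \<le> y} = {x \<in> space M. k \<le> (\<Sum>i\<in>{1..n}. if X i x \<le> y then 1 else 0)}"
    by (subst order_stat_iff_card[OF k, of "\<lambda>t. t \<le> y"])
      (simp_all only: card_eq_sum sum.inter_filter[OF finite_atLeastAtMost])
  also have "\<dots> \<in> events" using X by measurable
  finally show "{x \<in> space M. order_stat X k n x \<le> y} \<in> events" .
qed

text \<open>The limit is the entropy growth of the number of configurations plus the exponential
  rate of one configuration. At \<open>q = p\<close> the formula would give
  \<open>- rel_ent lam p\<close>.\<close>

lemma prob_order_stat_rate:
  fixes X :: "nat \<Rightarrow> 'a \<Rightarrow> real"
  assumes lam: "0 < lam" "lam < 1"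
    and k: "\<And>n. 1 \<le> n \<Longrightarrow> k n \<in> {1..n}"
    and lim: "(\<lambda>n. real (k n) / real n) \<longlonglongrightarrow> lam"
    and indep: "indep_vars (\<lambda>_. borel) X {1..}" and yz: "y < z"
    and p: "\<And>i. 1 \<le> i \<Longrightarrow> prob {x \<in> space M. X i x \<le> y} = p" "0 < p"
    and q: "\<And>i. 1 \<le> i \<Longrightarrow> prob {x \<in> space M. X i x \<le> z} = q" "p < q" "q < 1"
  obtains l where "l \<longlonglongrightarrow> lam * ln (p / lam) + (1 - lam) * ln ((1 - q) / (1 - lam))"
    "\<forall>\<^sub>F n in sequentially.
       exp (real n * l n) \<le> prob {x \<in> space M. order_stat X (k n) n x \<in> {y<..z}}"
proof -
  obtain g where g: "g \<longlonglongrightarrow> - (lam * ln lam) - (1 - lam) * ln (1 - lam)"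
    "\<forall>\<^sub>F n in sequentially. g n \<le> ln (real ((n - 1) choose (k n - 1))) / real n"
    using binomial_entropy_lower_bound[OF lam k lim] by blast
  \<comment> \<open>To \<open>g\<close> is added the logarithm of
    \<open>p ^ (k n - 1) * (q - p) * (1 - q) ^ (n - k n)\<close>, divided by \<open>n\<close>; the
    contribution of \<open>q - p\<close> disappears in the limit.\<close>
  define l where "l n = g n + ((real (k n) / real n - 1 / real n) * ln p + ln (q - p) / real n
    + (1 - real (k n) / real n) * ln (1 - q))" for n
  have "l \<longlonglongrightarrow> - (lam * ln lam) - (1 - lam) * ln (1 - lam)
      + ((lam - 0) * ln p + 0 + (1 - lam) * ln (1 - q))"
    unfolding l_def by (intro tendsto_intros g lim lim_const_over_n lim_1_over_n)
  also have "- (lam * ln lam) - (1 - lam) * ln (1 - lam)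
      + ((lam - 0) * ln p + 0 + (1 - lam) * ln (1 - q))
    = lam * ln (p / lam) + (1 - lam) * ln ((1 - q) / (1 - lam))"
    using lam p q by (simp add: ln_div algebra_simps)
  finally have "l \<longlonglongrightarrow> lam * ln (p / lam) + (1 - lam) * ln ((1 - q) / (1 - lam))" .
  moreover have "\<forall>\<^sub>F n in sequentially.
       exp (real n * l n) \<le> prob {x \<in> space M. order_stat X (k n) n x \<in> {y<..z}}"
    using g(2) eventually_ge_at_top[of 1]
  proof eventually_elim
    case (elim n)
    let ?C = "real ((n - 1) choose (k n - 1))"
    have kn: "k n \<in> {1..n}" using k elim by simp
    have C: "0 < ?C" using kn by auto
    have n: "0 < real n" using elim by simp
    have "real n * l n = real n * g n + (real (k n) - 1) * ln p + ln (q - p) + (real n - real (k n)) * ln (1 - q)"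
      using n by (simp add: l_def field_simps)
    also have "real n * g n \<le> ln ?C" using elim n by (simp add: field_simps)
    finally have "exp (real n * l n)
        \<le> exp (ln ?C + real (k n - 1) * ln p + ln (q - p) + real (n - k n) * ln (1 - q))"
      using kn by (simp add: of_nat_diff)
    also have "\<dots> = ?C * (p ^ (k n - 1) * (q - p) * (1 - q) ^ (n - k n))"
      using C p q by (simp add: exp_add exp_of_nat_mult)
    also have "\<dots> \<le> prob {x \<in> space M. order_stat X (k n) n x \<in> {y<..z}}"
    proof (rule prob_order_stat_ge[OF indep_vars_subset[OF indep] kn yz])
      have "random_variable borel (order_stat X (k n) n)"
        using indep by (intro random_variable_order_stat[OF kn]) (auto simp: indep_vars_def)
      thus "{x \<in> space M. order_stat X (k n) n x \<in> {y<..z}} \<in> events" by measurable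
    qed (use p q in auto)
    finally show ?case .
  qed
  ultimately show ?thesis using that by blast
qed

text \<open>For \<open>y\<close> and \<open>z\<close> inside the interval, the mass outside is at
  most \<open>F y + (1 - F z)\<close>, which can be made arbitrarily small.\<close>

lemma AE_in_regular_interval:
  fixes Y :: "'a \<Rightarrow> real"
  assumes Y [measurable]: "random_variable borel Y"
    and cdf: "\<And>y. prob {x \<in> space M. Y x \<le> y} = F y"
    and reg: "regular_on_interval F a b"
  shows "AE x in M. Y x \<in> einterval a b"
proof -
  have "prob {x \<in> space M. Y x \<notin> einterval a b} \<le> 0 + e" if e: "0 < e" for e
  proof -
    define d where "d = min (e / 2) (1 / 2)"
    have d: "0 < d" "d < 1" "d \<le> e / 2" using e by (auto simp: d_def)
    obtain y where y: "y \<in> einterval a b" "F y = d"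
      using regular_on_interval_surj[OF reg d(1,2)] .
    obtain z where z: "z \<in> einterval a b" "F z = 1 - d"
      using regular_on_interval_surj[OF reg, of "1 - d"] d by auto
    have "t \<in> einterval a b" if "y < t" "t \<le> z" for t
      using y z that unfolding einterval_iff
      by (meson ereal_less_eq(3) le_less_trans less_ereal.simps(1) order.strict_trans)
    hence "t \<le> y \<or> z < t" if "t \<notin> einterval a b" for t
      using that not_le by blast
    hence "prob {x \<in> space M. Y x \<notin> einterval a b}
        \<le> prob ({x \<in> space M. Y x \<le> y} \<union> (space M - {x \<in> space M. Y x \<le> z}))"
      by (intro finite_measure_mono) force+
    also have "\<dots> \<le> prob {x \<in> space M. Y x \<le> y} + prob (space M - {x \<in> space M. Y x \<le> z})"
      by (intro measure_Un_le) auto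
    also have "\<dots> = 2 * d"
      using y z by (subst prob_compl) (auto simp: cdf)
    finally show ?thesis using d by simp
  qed
  hence "prob {x \<in> space M. Y x \<notin> einterval a b} \<le> 0"
    by (rule field_le_epsilon)
  hence "prob {x \<in> space M. Y x \<notin> einterval a b} = 0"
    using measure_nonneg antisym by blast
  thus ?thesis
    by (subst (asm) prob_eq_0) auto
qed

end

section \<open>Comparisons inside the interval and counting for the upper tail\<close>

lemma einterval_between:
  assumes "y \<in> einterval a b" "z \<in> einterval a b" "y \<le> x" "x \<le> z"
  shows "x \<in> einterval a b"
  using assms unfolding einterval_iff
  by (meson ereal_less_eq(3) le_less_trans less_le_trans)

lemma regular_on_interval_le_iff:
  assumes "regular_on_interval F a b" "x \<in> einterval a b" "y \<in> einterval a b"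
  shows "F x \<le> F y \<longleftrightarrow> x \<le> y"
  using assms strict_mono_onD[of "einterval a b" F x y] strict_mono_onD[of "einterval a b" F y x]
  by (cases x y rule: linorder_cases) (auto simp: regular_on_interval_def)

text \<open>The order statistic is at least \<open>y\<close> iff at most \<open>k - 1\<close> points
  lie strictly below \<open>y\<close>; the complement then has at least \<open>n - k + 1\<close>
  points.\<close>

lemma card_order_stat_ge:
  assumes k: "k \<in> {1..n}"
  shows "y \<le> order_stat X k n x \<longleftrightarrow> n - k + 1 \<le> card {i \<in> {1..n}. X i x \<in> {y..}}"
proof -
  have "card {i \<in> {1..n}. X i x < y} + card {i \<in> {1..n}. X i x \<in> {y..}}
      = card ({i \<in> {1..n}. X i x < y} \<union> {i \<in> {1..n}. X i x \<in> {y..}})"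
    by (rule card_Un_disjoint[symmetric]) auto
  also have "{i \<in> {1..n}. X i x < y} \<union> {i \<in> {1..n}. X i x \<in> {y..}} = {1..n}"
    by auto
  finally have "card {i \<in> {1..n}. X i x < y} + card {i \<in> {1..n}. X i x \<in> {y..}} = n"
    by simp
  moreover have "y \<le> order_stat X k n x \<longleftrightarrow> \<not> k \<le> card {i \<in> {1..n}. X i x < y}"
    using order_stat_iff_card[OF k, of "\<lambda>t. t < y" X x] by auto
  moreover have "1 \<le> k" "k \<le> n" using k by auto
  ultimately show ?thesis by linarith
qed

subsection \<open>Rate estimates for an i.i.d. sample\<close>

locale iid_sample = prob_space M for M :: "'a measure" +
  fixes X :: "nat \<Rightarrow> 'a \<Rightarrow> real" and F :: "real \<Rightarrow> real" and a b :: ereal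
  assumes indep: "indep_vars (\<lambda>_. borel) X {1..}"
    and cdf_X: "\<And>n. 1 \<le> n \<Longrightarrow> cdf (distr M borel (X n)) = F"
    and F: "distribution_function F"
    and reg: "regular_on_interval F a b"
begin

lemma random_variable_X: "1 \<le> n \<Longrightarrow> random_variable borel (X n)"
  using indep by (simp add: indep_vars_def)

lemma random_variable_order_stat_X: "k \<in> {1..n} \<Longrightarrow> random_variable borel (order_stat X k n)"
  by (intro random_variable_order_stat) (auto intro: random_variable_X)

lemma isCont_F: "y \<in> einterval a b \<Longrightarrow> isCont F y"
  using reg by (simp add: regular_on_interval_def continuous_on_eq_continuous_at)

lemma prob_X_le:
  assumes "1 \<le> n"
  shows "prob {x \<in> space M. X n x \<le> y} = F y"
proof -
  note [measurable] = random_variable_X[OF assms]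
  have "F y = measure (distr M borel (X n)) {..y}"
    using cdf_X[OF assms] by (metis cdf_def2)
  also have "\<dots> = prob {x \<in> space M. X n x \<le> y}"
    by (subst measure_distr) (auto intro!: arg_cong[of _ _ prob])
  finally show ?thesis by simp
qed

text \<open>Continuity of \<open>F\<close> at \<open>y\<close> excludes an atom there, so closing
  the ray at \<open>y\<close> adds no mass.\<close>

lemma prob_X_ge:
  assumes n: "1 \<le> n" and y: "y \<in> einterval a b"
  shows "prob {x \<in> space M. X n x \<in> {y..}} = 1 - F y"
proof -
  note [measurable] = random_variable_X[OF n]
  interpret D: real_distribution "distr M borel (X n)" by (rule real_distribution_distr) simp
  have "measure (distr M borel (X n)) {y} = 0"
    using D.isCont_cdf[of y] isCont_F[OF y] by (simp add: cdf_X[OF n])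
  hence "prob {x \<in> space M. X n x = y} = 0"
    by (subst (asm) measure_distr) (auto simp: vimage_def Int_def conj_commute)
  moreover have "{x \<in> space M. X n x \<in> {y..}} = (space M - {x \<in> space M. X n x \<le> y}) \<union> {x \<in> space M. X n x = y}"
    by auto
  moreover have "prob ((space M - {x \<in> space M. X n x \<le> y}) \<union> {x \<in> space M. X n x = y})
      = prob (space M - {x \<in> space M. X n x \<le> y}) + prob {x \<in> space M. X n x = y}"
    by (intro finite_measure_Union) auto
  moreover have "prob (space M - {x \<in> space M. X n x \<le> y}) = 1 - F y"
    by (subst prob_compl) (auto simp: prob_X_le[OF n])
  ultimately show ?thesis by simp
qed

lemma AE_order_stat_in_interval:
  assumes k: "k \<in> {1..n}"
  shows "AE x in M. order_stat X k n x \<in> einterval a b"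
proof -
  have "AE x in M. \<forall>i\<in>{1..n}. X i x \<in> einterval a b"
    by (intro AE_finite_allI AE_in_regular_interval[OF random_variable_X prob_X_le reg]) auto
  thus ?thesis
    by eventually_elim (intro order_stat_mem[OF k], auto)
qed

text \<open>A small window around \<open>m\<close> inside \<open>G\<close> already has nearly the
  required rate, and continuity of \<open>F\<close> lets the window shrink to
  \<open>m\<close>.\<close>

lemma liminf_order_stat:
  assumes lam: "0 < lam" "lam < 1"
    and k: "\<And>n. 1 \<le> n \<Longrightarrow> k n \<in> {1..n}"
    and lim: "(\<lambda>n. real (k n) / real n) \<longlonglongrightarrow> lam"
    and G: "open G" "G \<subseteq> einterval a b" and m: "m \<in> G"
  shows "ereal (- rel_ent lam (F m))
    \<le> liminf (\<lambda>n. ereal (1 / real n) * log_prob (prob {x \<in> space M. order_stat X (k n) n x \<in> G}))"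
proof (rule dense_le)
  fix c assume c: "c < ereal (- rel_ent lam (F m))"
  have mJ: "m \<in> einterval a b" using m G by auto
  note Fm = regular_on_interval_bounds[OF F reg mJ]
  obtain d where d: "0 < d" "cball m d \<subseteq> G" using G(1) m open_contains_cball by blast
  \<comment> \<open>This is the limiting rate of the window from \<open>m - e\<close> to
    \<open>m + e\<close> given by \<open>prob_order_stat_rate\<close>.\<close>
  define \<phi> where "\<phi> e = lam * ln (F (m - e) / lam) + (1 - lam) * ln ((1 - F (m + e)) / (1 - lam))"
    for e
  have F_lim: "((\<lambda>e. F (m - e)) \<longlongrightarrow> F m) (at_right 0)" "((\<lambda>e. F (m + e)) \<longlongrightarrow> F m) (at_right 0)"
    by (rule isCont_tendsto_compose[OF isCont_F[OF mJ]]; auto intro!: tendsto_eq_intros)+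
  have "(\<phi> \<longlongrightarrow> lam * ln (F m / lam) + (1 - lam) * ln ((1 - F m) / (1 - lam))) (at_right 0)"
    unfolding \<phi>_def by (intro tendsto_intros F_lim) (use Fm lam in auto)
  also have "lam * ln (F m / lam) + (1 - lam) * ln ((1 - F m) / (1 - lam)) = - rel_ent lam (F m)"
    using lam Fm by (simp add: rel_ent_def ln_div algebra_simps)
  finally have "((\<lambda>e. ereal (\<phi> e)) \<longlongrightarrow> ereal (- rel_ent lam (F m))) (at_right 0)" by simp
  hence "\<forall>\<^sub>F e in at_right 0. c < ereal (\<phi> e)" using c by (rule order_tendstoD)
  moreover have "\<forall>\<^sub>F e in at_right 0. e \<in> {0<..<d}" using d(1) by (rule eventually_at_right_real)
  ultimately have "\<forall>\<^sub>F e in at_right 0. c < ereal (\<phi> e) \<and> e \<in> {0<..<d}" by (rule eventually_conj)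
  then obtain e where e: "c < ereal (\<phi> e)" "0 < e" "e < d"
    using eventually_happens[of _ "at_right (0::real)"] by fastforce
  have sub: "{m - e<..m + e} \<subseteq> G" "m - e \<in> G" "m + e \<in> G"
    using d(2) e by (auto simp: cball_def dist_real_def intro!: subsetD[OF d(2)])
  hence J: "m - e \<in> einterval a b" "m + e \<in> einterval a b" using G(2) by auto
  have "F (m - e) < F (m + e)"
    using regular_on_interval_le_iff[OF reg J(2,1)] e by (simp add: not_le[symmetric])
  then obtain l where l: "l \<longlonglongrightarrow> \<phi> e"
    "\<forall>\<^sub>F n in sequentially.
       exp (real n * l n) \<le> prob {x \<in> space M. order_stat X (k n) n x \<in> {m - e<..m + e}}"
    unfolding \<phi>_def
    using prob_order_stat_rate[OF lam k lim indep _ prob_X_le _ prob_X_le, of "m - e" "m + e"]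
      regular_on_interval_bounds[OF F reg J(1)] regular_on_interval_bounds[OF F reg J(2)] e
    by auto
  have "\<forall>\<^sub>F n in sequentially. ereal (l n)
      \<le> ereal (1 / real n) * log_prob (prob {x \<in> space M. order_stat X (k n) n x \<in> G})"
    using l(2) eventually_ge_at_top[of 1]
  proof eventually_elim
    case (elim n)
    note [measurable] = random_variable_order_stat_X[OF k[OF elim(2)]] borel_open[OF G(1)]
    have "prob {x \<in> space M. order_stat X (k n) n x \<in> {m - e<..m + e}}
        \<le> prob {x \<in> space M. order_stat X (k n) n x \<in> G}"
      using sub by (intro finite_measure_mono) auto
    with elim show ?case by (intro log_prob_ge) auto
  qed
  hence "liminf (\<lambda>n. ereal (l n))
      \<le> liminf (\<lambda>n. ereal (1 / real n) * log_prob (prob {x \<in> space M. order_stat X (k n) n x \<in> G}))"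
    by (rule Liminf_mono)
  moreover have "liminf (\<lambda>n. ereal (l n)) = ereal (\<phi> e)"
    using l(1) by (intro lim_imp_Liminf) auto
  ultimately show "c \<le> liminf (\<lambda>n. ereal (1 / real n) * log_prob (prob {x \<in> space M. order_stat X (k n) n x \<in> G}))"
    using e(1) by auto
qed

text \<open>By monotonicity of the relative entropy on both sides of
  \<open>lam\<close>, the order statistic lies in \<open>G\<close> only if it is beyond one of two quantiles at which
  the rate equals \<open>s\<close>.\<close>

lemma limsup_order_stat:
  assumes lam: "0 < lam" "lam < 1"
    and k: "\<And>n. 1 \<le> n \<Longrightarrow> k n \<in> {1..n}"
    and lim: "(\<lambda>n. real (k n) / real n) \<longlonglongrightarrow> lam"
    and G: "G \<subseteq> einterval a b"
    and s: "0 \<le> s" "\<And>m. m \<in> G \<Longrightarrow> s \<le> rel_ent lam (F m)"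
  shows "limsup (\<lambda>n. ereal (1 / real n) * log_prob (prob {x \<in> space M. order_stat X (k n) n x \<in> G}))
    \<le> ereal (- s)"
proof -
  obtain p q where pq: "0 < p" "p \<le> lam" "lam \<le> q" "q < 1" "rel_ent lam p = s" "rel_ent lam q = s"
    "\<And>h. 0 < h \<Longrightarrow> h < 1 \<Longrightarrow> s \<le> rel_ent lam h \<Longrightarrow> h \<le> p \<or> q \<le> h"
    using rel_ent_level[OF lam s(1)] by metis
  obtain y where y: "y \<in> einterval a b" "F y = p"
    using regular_on_interval_surj[OF reg, of p] pq lam by auto
  obtain z where z: "z \<in> einterval a b" "F z = q"
    using regular_on_interval_surj[OF reg, of q] pq lam by auto
  have G_sub: "m \<le> y \<or> z \<le> m" if "m \<in> G" for m
  proof -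
    have m: "m \<in> einterval a b" using that G by auto
    have "F m \<le> F y \<or> F z \<le> F m"
      using pq(7)[OF regular_on_interval_bounds[OF F reg m] s(2)[OF that]] y z by simp
    thus ?thesis
      using regular_on_interval_le_iff[OF reg] m y z by auto
  qed
  obtain u where u: "u \<longlonglongrightarrow> - rel_ent lam p"
    "\<And>n. 1 \<le> n \<Longrightarrow> prob {x \<in> space M. k n \<le> card {i \<in> {1..n}. X i x \<in> {..y}}} \<le> exp (real n * u n)"
    using prob_card_ge_rate[OF indep, of "{..y}" p lam k] prob_X_le[of _ y] y pq lam lim by auto
  \<comment> \<open>The upper tail requires \<open>n - k n + 1\<close> points beyond
    \<open>z\<close>, a fraction tending to \<open>1 - lam\<close>.\<close>
  have "(\<lambda>n. 1 - real (k n) / real n + 1 / real n) \<longlonglongrightarrow> 1 - lam + 0"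
    by (intro tendsto_intros lim lim_1_over_n)
  moreover have "\<forall>\<^sub>F n in sequentially. 1 - real (k n) / real n + 1 / real n = real (n - k n + 1) / real n"
    using eventually_ge_at_top[of 1]
  proof eventually_elim
    case (elim n)
    thus ?case using k[of n] by (simp add: of_nat_diff field_simps)
  qed
  ultimately have lim': "(\<lambda>n. real (n - k n + 1) / real n) \<longlonglongrightarrow> 1 - lam"
    using Lim_transform_eventually by force
  \<comment> \<open>The same exponential bound is used with hits counted above \<open>z\<close>;
    \<open>rel_ent_swap\<close> turns its rate into \<open>rel_ent lam q\<close>, which is
    \<open>s\<close>.\<close>
  obtain v where v: "v \<longlonglongrightarrow> - rel_ent (1 - lam) (1 - q)"
    "\<And>n. 1 \<le> n \<Longrightarrow> prob {x \<in> space M. n - k n + 1 \<le> card {i \<in> {1..n}. X i x \<in> {z..}}} \<le> exp (real n * v n)"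
    using prob_card_ge_rate[OF indep, of "{z..}" "1 - q" "1 - lam" "\<lambda>n. n - k n + 1"]
      prob_X_ge[OF _ z(1)] z(2) pq lam lim' by auto
  \<comment> \<open>A sum of two exponentials is at most twice the larger one, which costs
    \<open>ln 2 / n\<close>.\<close>
  define w where "w n = max (u n) (v n) + ln 2 / real n" for n
  have "w \<longlonglongrightarrow> max (- rel_ent lam p) (- rel_ent (1 - lam) (1 - q)) + 0"
    unfolding w_def by (intro tendsto_intros u(1) v(1) lim_const_over_n)
  hence w: "w \<longlonglongrightarrow> - s" using pq by (simp add: rel_ent_swap)
  have "\<forall>\<^sub>F n in sequentially.
      ereal (1 / real n) * log_prob (prob {x \<in> space M. order_stat X (k n) n x \<in> G}) \<le> ereal (w n)"
    using eventually_ge_at_top[of 1]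
  proof eventually_elim
    case (elim n)
    note kn = k[OF elim]
    note [measurable] = random_variable_order_stat_X[OF kn]
    have "prob {x \<in> space M. order_stat X (k n) n x \<in> G}
        \<le> prob ({x \<in> space M. order_stat X (k n) n x \<le> y} \<union> {x \<in> space M. z \<le> order_stat X (k n) n x})"
      using G_sub by (intro finite_measure_mono) auto
    also have "\<dots> \<le> prob {x \<in> space M. order_stat X (k n) n x \<le> y}
        + prob {x \<in> space M. z \<le> order_stat X (k n) n x}"
      by (intro measure_Un_le) auto
    also have "\<dots> \<le> exp (real n * u n) + exp (real n * v n)"
      using u(2)[OF elim] v(2)[OF elim] order_stat_iff_card[OF kn, of "\<lambda>t. t \<le> y" X]
        card_order_stat_ge[OF kn, of z X]
      by (intro add_mono) auto
    also have "\<dots> \<le> 2 * exp (real n * max (u n) (v n))"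
      by (simp add: max_def mult_left_mono)
    also have "\<dots> = exp (real n * w n)"
      using elim by (simp add: w_def distrib_left exp_add)
    finally show ?case using elim by (intro log_prob_le) auto
  qed
  hence "limsup (\<lambda>n. ereal (1 / real n) * log_prob (prob {x \<in> space M. order_stat X (k n) n x \<in> G}))
      \<le> limsup (\<lambda>n. ereal (w n))"
    by (rule Limsup_mono)
  also have "limsup (\<lambda>n. ereal (w n)) = ereal (- s)"
    using w by (intro lim_imp_Limsup) auto
  finally show ?thesis .
qed

text \<open>Monotonicity of \<open>F\<close> pulls the interval of admissible values of
  \<open>F\<close> back to a closed interval between two quantiles. Its compactness makes the rate
  function good.\<close>

lemma rel_ent_level_set:
  assumes lam: "0 < lam" "lam < 1" and s: "0 \<le> s"
  obtains y z where "{y..z} \<subseteq> einterval a b"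
    "{m \<in> einterval a b. rel_ent lam (F m) \<le> s} = {y..z}"
proof -
  obtain p q where pq: "0 < p" "p \<le> lam" "lam \<le> q" "q < 1"
    "\<And>h. 0 < h \<Longrightarrow> h < 1 \<Longrightarrow> rel_ent lam h \<le> s \<longleftrightarrow> p \<le> h \<and> h \<le> q"
    using rel_ent_level[OF lam s(1)] by metis
  obtain y where y: "y \<in> einterval a b" "F y = p"
    using regular_on_interval_surj[OF reg, of p] pq lam by auto
  obtain z where z: "z \<in> einterval a b" "F z = q"
    using regular_on_interval_surj[OF reg, of q] pq lam by auto
  have sub: "{y..z} \<subseteq> einterval a b"
    using einterval_between[OF y(1) z(1)] by auto
  have "rel_ent lam (F m) \<le> s \<longleftrightarrow> y \<le> m \<and> m \<le> z" if m: "m \<in> einterval a b" for m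
    using pq(5)[OF regular_on_interval_bounds[OF F reg m]]
      regular_on_interval_le_iff[OF reg y(1) m] regular_on_interval_le_iff[OF reg m z(1)] y z by simp
  with sub show ?thesis by (intro that[of y z]) auto
qed

end

subsection \<open>The large deviation principle\<close>

theorem proposition3p1:
  fixes lam :: real and k :: "nat \<Rightarrow> nat"
    and \<Theta> :: "real set" and F :: "real \<Rightarrow> real \<Rightarrow> real"
    and \<alpha> \<omega> :: "real \<Rightarrow> ereal" and \<theta>\<^sub>0 :: real
    and P :: "'a measure" and X :: "nat \<Rightarrow> 'a \<Rightarrow> real"
  assumes "0 < lam" and "lam < 1"
    and "\<And>n. 1 \<le> n \<Longrightarrow> k n \<in> {1..n}"
    and "(\<lambda>n. real (k n) / real n) \<longlonglongrightarrow> lam"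
    and "\<And>\<theta>. \<theta> \<in> \<Theta> \<Longrightarrow> distribution_function (F \<theta>)"
    and "\<And>\<theta>. \<theta> \<in> \<Theta> \<Longrightarrow> regular_on_interval (F \<theta>) (\<alpha> \<theta>) (\<omega> \<theta>)"
    and "\<And>m. m \<in> (\<Union>\<theta>\<in>\<Theta>. einterval (\<alpha> \<theta>) (\<omega> \<theta>)) \<Longrightarrow>
           \<exists>!\<theta>. \<theta> \<in> \<Theta> \<and> quantile (F \<theta>) (\<alpha> \<theta>) (\<omega> \<theta>) lam = m"
    and "\<theta>\<^sub>0 \<in> \<Theta>"
    and "prob_space P"
    and "prob_space.indep_vars P (\<lambda>_. borel) X {1..}"
    and "\<And>n. 1 \<le> n \<Longrightarrow> cdf (distr P borel (X n)) = F \<theta>\<^sub>0"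
    and "continuous_on (einterval (\<alpha> \<theta>\<^sub>0) (\<omega> \<theta>\<^sub>0)) (theta_of \<Theta> F \<alpha> \<omega> lam)"
  shows "satisfies_LDP (completion P) (top_of_set \<Theta>)
           (\<lambda>n x. theta_of \<Theta> F \<alpha> \<omega> lam (order_stat X (k n) n x))
           (rate_I \<Theta> F \<alpha> \<omega> lam \<theta>\<^sub>0)
         \<and> good_rate_function (top_of_set \<Theta>) (rate_I \<Theta> F \<alpha> \<omega> lam \<theta>\<^sub>0)"
proof -
  let ?J = "einterval (\<alpha> \<theta>\<^sub>0) (\<omega> \<theta>\<^sub>0)"
  define T where "T = theta_of \<Theta> F \<alpha> \<omega> lam"
  define q where "q \<theta> = quantile (F \<theta>) (\<alpha> \<theta>) (\<omega> \<theta>) lam" for \<theta>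
  define M where "M n = order_stat X (k n) n" for n
  define I where "I = rate_I \<Theta> F \<alpha> \<omega> lam \<theta>\<^sub>0"
  note lam = assms(1,2) and k = assms(3,4) and uniq = assms(7)[folded q_def]
  note F = assms(5)[OF assms(8)] and reg = assms(6)[OF assms(8)]
  interpret iid_sample P X "F \<theta>\<^sub>0" "\<alpha> \<theta>\<^sub>0" "\<omega> \<theta>\<^sub>0"
    by (intro iid_sample.intro iid_sample_axioms.intro assms F reg)
  \<comment> \<open>The order statistic may leave \<open>?J\<close> on a null set, where nothing is
    known about \<open>T\<close>; the completion makes the resulting events measurable.\<close>
  interpret completion: complete_measure "completion P" ..

  \<comment> \<open>The map \<open>T\<close> and its inverse \<open>q\<close>, and the rate function
    in terms of \<open>m\<close>\<close>
  have qT: "T m \<in> \<Theta>" "q (T m) = m" if "m \<in> ?J" for m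
    using theI'[OF uniq, of m] that assms(8) by (auto simp: T_def theta_of_def q_def)
  \<comment> \<open>The point \<open>q \<theta>\<close> lies in the interval belonging to
    \<open>\<theta>\<close>, so uniqueness applies even when it is outside
    \<open>?J\<close>.\<close>
  have Tq: "T (q \<theta>) = \<theta>" if "\<theta> \<in> \<Theta>" for \<theta>
    unfolding T_def theta_of_def q_def[symmetric]
    using quantile_props(1)[OF assms(6) lam] that by (intro the1_equality uniq) (auto simp: q_def)
  have contT: "continuous_on ?J T" using assms(12) by (simp add: T_def)
  have I_T: "I (T m) = ereal (rel_ent lam (F \<theta>\<^sub>0 m))" if "m \<in> ?J" for m
    using qT[OF that] that by (simp add: I_def rate_I_def Let_def q_def rel_ent_def)
  have I_infinite: "I \<theta> = \<infinity>" if "\<theta> \<in> \<Theta>" "q \<theta> \<notin> ?J" for \<theta>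
    using that by (simp add: I_def rate_I_def Let_def q_def)
  have I_nonneg: "0 \<le> I \<theta>" if "\<theta> \<in> \<Theta>" for \<theta>
  proof (cases "q \<theta> \<in> ?J")
    case True
    thus ?thesis
      using I_T[OF True] rel_ent_nonneg[OF lam regular_on_interval_bounds[OF F reg True]] Tq[OF that]
      by simp
  qed (use I_infinite that in simp)

  \<comment> \<open>Goodness and lower semicontinuity of the rate function\<close>
  have compact_level: "compact {\<theta> \<in> \<Theta>. I \<theta> \<le> ereal \<eta>}" if \<eta>: "0 \<le> \<eta>" for \<eta>
  proof -
    obtain y z where yz: "{y..z} \<subseteq> ?J" "{m \<in> ?J. rel_ent lam (F \<theta>\<^sub>0 m) \<le> \<eta>} = {y..z}"
      using rel_ent_level_set[OF lam \<eta>] .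
    \<comment> \<open>A finite rate forces \<open>q \<theta>\<close> into \<open>?J\<close>, so the
      level set is the continuous image of a compact interval.\<close>
    have "{\<theta> \<in> \<Theta>. I \<theta> \<le> ereal \<eta>} = T ` {m \<in> ?J. rel_ent lam (F \<theta>\<^sub>0 m) \<le> \<eta>}"
    proof (intro equalityI subsetI)
      fix \<theta> assume \<theta>: "\<theta> \<in> {\<theta> \<in> \<Theta>. I \<theta> \<le> ereal \<eta>}"
      hence "q \<theta> \<in> ?J" using I_infinite by fastforce
      with \<theta> show "\<theta> \<in> T ` {m \<in> ?J. rel_ent lam (F \<theta>\<^sub>0 m) \<le> \<eta>}"
        using I_T[of "q \<theta>"] Tq by (intro image_eqI[of _ _ "q \<theta>"]) auto
    qed (use I_T qT in auto)
    thus ?thesis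
      unfolding yz(2) using compact_continuous_image[OF continuous_on_subset[OF contT yz(1)]] by simp
  qed

  \<comment> \<open>For a real nonnegative level the complement is a compact level set, hence
    closed; below zero every parameter qualifies.\<close>
  have lsc: "openin (top_of_set \<Theta>) {\<theta> \<in> \<Theta>. c < I \<theta>}" for c
  proof (cases c)
    case (real r)
    show ?thesis
    proof (cases "0 \<le> r")
      case True
      have "{\<theta> \<in> \<Theta>. c < I \<theta>} = \<Theta> - {\<theta> \<in> \<Theta>. I \<theta> \<le> ereal r}"
        using real by (auto simp: not_le)
      thus ?thesis
        using compact_imp_closed[OF compact_level[OF True]]
        by (metis Diff_Compl Diff_eq open_Compl openin_open_Int)
    next
      case False
      hence "{\<theta> \<in> \<Theta>. c < I \<theta>} = \<Theta>"
        using I_nonneg real by (auto intro: less_le_trans[of _ 0])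
      thus ?thesis by simp
    qed
  next
    case MInf
    hence "{\<theta> \<in> \<Theta>. c < I \<theta>} = \<Theta>"
      using I_nonneg by (auto intro: less_le_trans[of _ 0])
    thus ?thesis by simp
  qed auto

  have rate: "rate_function (top_of_set \<Theta>) I"
    using I_nonneg lsc by (simp add: rate_function_def lower_semicontinuous_on_def)
  have good: "good_rate_function (top_of_set \<Theta>) I"
    using rate compact_level by (auto simp: good_rate_function_def compactin_subtopology)

  \<comment> \<open>Transfer of events from the parameter to the order statistic\<close>
  define pre where "pre A = {m \<in> ?J. T m \<in> A}" for A
  have open_pre: "open (pre U)" if "openin (top_of_set \<Theta>) U" for U
  proof -
    have "openin (top_of_set ?J) (?J \<inter> T -` U)"
      using contT _ that by (rule continuous_openin_preimage) (use qT in auto)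
    hence "open (?J \<inter> T -` U)"
      using openin_open_trans open_einterval by blast
    thus ?thesis by (simp add: pre_def Int_def)
  qed
  \<comment> \<open>Inside \<open>?J\<close> the preimage of \<open>C\<close> is the complement of
    the open preimage of \<open>\<Theta> - C\<close>.\<close>
  have borel_pre: "pre C \<in> sets borel" if "closedin (top_of_set \<Theta>) C" for C
  proof -
    have "openin (top_of_set \<Theta>) (\<Theta> - C)" using that by (simp add: closedin_def)
    moreover have "pre C = ?J - pre (\<Theta> - C)" using qT by (auto simp: pre_def)
    ultimately show ?thesis using open_pre borel_open[of "pre (\<Theta> - C)"] by auto
  qed

  have AE_J: "AE x in completion P. M n x \<in> ?J" if "1 \<le> n" for n
    using AE_completion[OF AE_order_stat_in_interval[OF k(1)[OF that]]] by (simp add: M_def)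
  \<comment> \<open>The two events can differ only where the order statistic leaves
    \<open>?J\<close>, which is a null set.\<close>
  have events: "{x \<in> space P. T (M n x) \<in> A} \<in> sets (completion P)"
    "measure (completion P) {x \<in> space P. T (M n x) \<in> A} = prob {x \<in> space P. M n x \<in> pre A}"
    if A: "pre A \<in> sets borel" and n: "1 \<le> n" for A n
  proof -
    have "random_variable borel (M n)"
      using random_variable_order_stat_X[OF k(1)[OF n]] by (simp add: M_def)
    hence ev: "{x \<in> space P. M n x \<in> pre A} \<in> events" using A by measurable
    have ae: "AE x in completion P.
        x \<in> {x \<in> space P. M n x \<in> pre A} \<longleftrightarrow> x \<in> {x \<in> space P. T (M n x) \<in> A}"
      using AE_J[OF n] by eventually_elim (auto simp: pre_def)
    show *: "{x \<in> space P. T (M n x) \<in> A} \<in> sets (completion P)"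
      using ae ev by (rule completion.in_sets_AE[OF _ sets_completionI_sets]) auto
    have "measure (completion P) {x \<in> space P. M n x \<in> pre A}
        = measure (completion P) {x \<in> space P. T (M n x) \<in> A}"
      using ae ev * by (intro measure_eq_AE) auto
    thus "measure (completion P) {x \<in> space P. T (M n x) \<in> A} = prob {x \<in> space P. M n x \<in> pre A}"
      using ev by simp
  qed
  \<comment> \<open>The index 0, at which \<open>k\<close> is unconstrained, is avoided; eventual
    equality is enough for the limits.\<close>
  have log_prob_eq: "\<forall>\<^sub>F n in sequentially.
      ereal (1 / real n) * log_prob (measure (completion P) {x \<in> space (completion P). T (M n x) \<in> A})
      = ereal (1 / real n) * log_prob (prob {x \<in> space P. order_stat X (k n) n x \<in> pre A})"
    if "pre A \<in> sets borel" for A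
    using eventually_ge_at_top[of 1] by eventually_elim (simp add: events(2)[OF that, unfolded M_def] M_def)

  have rv: "as_random_variable (completion P) (top_of_set \<Theta>) (\<lambda>x. T (M n x))" if "1 \<le> n" for n
  proof -
    have "AE x in completion P. T (M n x) \<in> \<Theta>"
      using AE_J[OF that] by eventually_elim (rule qT)
    thus ?thesis
      using events(1)[OF borel_open[OF open_pre] that] by (simp add: as_random_variable_def)
  qed

  \<comment> \<open>The two large deviation bounds\<close>
  have lower: "- (INF w\<in>U. I w) \<le> liminf (\<lambda>n. ereal (1 / real n) *
      log_prob (measure (completion P) {x \<in> space (completion P). T (M n x) \<in> U}))" (is "_ \<le> ?L")
    if U: "openin (top_of_set \<Theta>) U" for U
  proof -
    \<comment> \<open>A bound at each point of \<open>U\<close> suffices for the infimum; points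
      with infinite rate satisfy it trivially.\<close>
    have "- ?L \<le> I w" if w: "w \<in> U" for w
    proof (cases "q w \<in> ?J")
      case True
      have w\<Theta>: "w \<in> \<Theta>" using w U openin_imp_subset by blast
      have "ereal (- rel_ent lam (F \<theta>\<^sub>0 (q w))) \<le> liminf (\<lambda>n. ereal (1 / real n) *
          log_prob (prob {x \<in> space P. order_stat X (k n) n x \<in> pre U}))"
        by (rule liminf_order_stat[OF lam k open_pre[OF U]]) (use True w Tq[OF w\<Theta>] in \<open>auto simp: pre_def\<close>)
      also have "\<dots> = ?L"
        by (rule Liminf_eq[OF log_prob_eq[OF borel_open[OF open_pre[OF U]]], symmetric])
      finally have "- I w \<le> ?L" using I_T[OF True] Tq[OF w\<Theta>] by simp
      thus ?thesis by (simp add: ereal_uminus_le_reorder)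
    next
      case False
      thus ?thesis using I_infinite w U openin_imp_subset by fastforce
    qed
    hence "- ?L \<le> (INF w\<in>U. I w)" by (rule INF_greatest)
    thus ?thesis by (simp add: ereal_uminus_le_reorder)
  qed

  have upper: "limsup (\<lambda>n. ereal (1 / real n) *
      log_prob (measure (completion P) {x \<in> space (completion P). T (M n x) \<in> C})) \<le> - (INF w\<in>C. I w)"
    (is "?L \<le> _") if C: "closedin (top_of_set \<Theta>) C" for C
  proof -
    have C\<Theta>: "C \<subseteq> \<Theta>" using C closedin_imp_subset by blast
    have "(INF w\<in>C. I w) \<le> - ?L"
    \<comment> \<open>Working with real \<open>c\<close> below the infimum also covers an infinite
      infimum, for instance when \<open>C\<close> is empty.\<close>
    proof (rule dense_le)
      fix c assume c: "c < (INF w\<in>C. I w)"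
      show "c \<le> - ?L"
      proof (cases c)
        case (real r)
        \<comment> \<open>The tail bound needs a nonnegative level; replacing \<open>r\<close> by 0
          when it is negative is harmless since \<open>I\<close> is nonnegative.\<close>
        define s where "s = max 0 r"
        have "ereal s \<le> I w" if "w \<in> C" for w
          using less_INF_D[OF c that] I_nonneg[of w] that C\<Theta>
          by (auto simp: s_def max_def real zero_ereal_def[symmetric])
        hence s: "s \<le> rel_ent lam (F \<theta>\<^sub>0 m)" if "m \<in> pre C" for m
          using that I_T[of m] by (force simp: pre_def)
        have "?L = limsup (\<lambda>n. ereal (1 / real n) *
            log_prob (prob {x \<in> space P. order_stat X (k n) n x \<in> pre C}))"
          by (rule Limsup_eq[OF log_prob_eq[OF borel_pre[OF C]]])
        also have "\<dots> \<le> ereal (- s)"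
          by (rule limsup_order_stat[OF lam k _ _ s]) (auto simp: pre_def s_def)
        finally have "ereal s \<le> - ?L" by (subst ereal_minus_le_minus[symmetric]) simp
        thus ?thesis using real by (auto simp: s_def intro: order.trans[rotated])
      qed (use c in auto)
    qed
    thus ?thesis by (subst ereal_minus_le_minus[symmetric]) simp
  qed

  show ?thesis
    using rate good rv lower upper
    unfolding satisfies_LDP_def T_def[symmetric] M_def[symmetric] I_def[symmetric] by blast
qed

end
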